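(* Let $\mathcal{H}$ be a real Hilbert space, let $S\subseteq\mathcal{H}$ be a closed and convex set, and let $c\in\mathcal{H}$ be such that $\mathcal{M}(c)=\operatorname{argmax}_{x\in S}\langle c,x\rangle$ is nonempty. Let $x_0\in\mathcal{H}$. Then $$\lim_{\eta\to\infty}P_S(x_0+\eta c)=P_{\mathcal{M}(c)}(x_0),$$ where the limit is taken over real $\eta\to\infty$ and convergence is strong, i.e. in the norm of $\mathcal{H}$.
   Context: $\|\cdot\|$ denotes the norm induced by the inner product $\langle\cdot,\cdot\rangle$ of $\mathcal{H}$. The set of maximizers is $\mathcal{M}(c)=\{x\in S:\langle c,x\rangle\ge\langle c,z\rangle\ \text{for all } z\in S\}$; it is closed and convex. For a nonempty closed convex set $C\subseteq\mathcal{H}$ and $x\in\mathcal{H}$, $P_C(x)$ denotes the orthogonal projection of $x$ onto $C$, i.e. the unique point of $C$ closest to $x$: $P_C(x)=\operatorname{argmin}_{y\in C}\|y-x\|$. *)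

theory Defs
  imports "HOL-Analysis.Analysis"
begin

definition maximizers :: "'a::real_inner set \<Rightarrow> 'a \<Rightarrow> 'a set"
  where "maximizers S c = {x \<in> S. \<forall>z\<in>S. inner c x \<ge> inner c z}"

text \<open>
  The library's \<open>closest_point\<close> requires the sort \<open>heine_borel\<close>, which excludes
  infinite-dimensional Hilbert spaces. The value below is meaningful whenever there is
  exactly one closest point, in particular for nonempty closed convex \<open>C\<close> in a complete space.
\<close>

definition orth_proj :: "'a::real_inner set \<Rightarrow> 'a \<Rightarrow> 'a"
  where "orth_proj C x = (THE y. y \<in> C \<and> (\<forall>z\<in>C. norm (y - x) \<le> norm (z - x)))"

end

theory Submission
  imports Defs
begin

text \<open>
  Put \<open>x\<^sub>\<eta> = P\<^sub>S(x\<^sub>0 + \<eta> c)\<close> and \<open>p = P\<^bsub>M(c)\<^esub>(x\<^sub>0)\<close>. The variational inequalities of the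
  projections give, for \<open>0 \<le> \<eta> < \<mu>\<close>,
  \<open>\<parallel>x\<^sub>\<mu> - x\<^sub>\<eta>\<parallel>\<^sup>2 \<le> \<parallel>x\<^sub>\<mu> - x\<^sub>0\<parallel>\<^sup>2 - \<parallel>x\<^sub>\<eta> - x\<^sub>0\<parallel>\<^sup>2\<close> and
  \<open>\<parallel>p - x\<^sub>\<eta>\<parallel>\<^sup>2 \<le> \<parallel>p - x\<^sub>0\<parallel>\<^sup>2 - \<parallel>x\<^sub>\<eta> - x\<^sub>0\<parallel>\<^sup>2\<close>. Hence \<open>\<parallel>x\<^sub>\<eta> - x\<^sub>0\<parallel>\<close> is increasing and bounded, so
  \<open>x\<^sub>n\<close> is a Cauchy sequence; no weak compactness is needed. Its limit lies in \<open>M(c)\<close>, since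
  \<open>\<langle>c, p - x\<^sub>\<eta>\<rangle> = O(1/\<eta>)\<close>, and is at most as far from \<open>x\<^sub>0\<close> as \<open>p\<close>, so it is \<open>p\<close>. Therefore
  \<open>\<parallel>x\<^sub>\<eta> - x\<^sub>0\<parallel>\<close> increases to \<open>\<parallel>p - x\<^sub>0\<parallel>\<close>, and the second inequality gives \<open>x\<^sub>\<eta> \<rightarrow> p\<close>.
\<close>

section \<open>Projections onto closed convex sets in a complete inner product space\<close>

text \<open>Serves two sequences: a minimizing one for the distance to a set, and the projections
  along the ray. In both, \<open>e n\<close> measures how far a squared distance is from its
  limit.\<close>

lemma Cauchy_if_norm_diff_square_le:
  fixes u :: "nat \<Rightarrow> 'a::real_normed_vector"
  assumes le: "\<And>m n. (norm (u m - u n))\<^sup>2 \<le> e m + e n" and e: "e \<longlonglongrightarrow> 0"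
  shows "Cauchy u"
proof (rule CauchyI)
  fix r :: real assume r: "0 < r"
  then have "\<forall>\<^sub>F n in sequentially. e n < r\<^sup>2 / 2"
    using e by (intro order_tendstoD) auto
  then obtain M where M: "\<And>n. n \<ge> M \<Longrightarrow> e n < r\<^sup>2 / 2"
    by (auto simp: eventually_sequentially)
  have "norm (u m - u n) < r" if "m \<ge> M" "n \<ge> M" for m n
  proof -
    have "(norm (u m - u n))\<^sup>2 < r\<^sup>2"
      using le[of m n] M[OF that(1)] M[OF that(2)] by linarith
    then show ?thesis by (rule power2_less_imp_less) (use r in simp)
  qed
  then show "\<exists>M. \<forall>m\<ge>M. \<forall>n\<ge>M. norm (u m - u n) < r" by blast
qed

text \<open>By the parallelogram law a minimizing sequence \<open>u\<close> is Cauchy; completeness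
  provides its limit and closedness keeps it in \<open>C\<close>.\<close>

lemma closest_point_exists_complete:
  fixes C :: "'a::{real_inner, complete_space} set"
  assumes "closed C" "convex C" "C \<noteq> {}"
  shows "\<exists>y\<in>C. \<forall>z\<in>C. dist x y \<le> dist x z"
proof -
  define d where "d = infdist x C"
  have "\<exists>y\<in>C. dist x y < d + inverse (real (Suc n))" for n
    using cINF_less_iff[of C "dist x" "d + inverse (real (Suc n))"] assms(3)
    by (auto simp: d_def infdist_notempty intro!: bdd_belowI[of _ 0])
  then obtain u where u: "\<And>n. u n \<in> C" "\<And>n. dist x (u n) < d + inverse (real (Suc n))"
    by metis
  have ge: "d \<le> dist x z" if "z \<in> C" for z
    using that by (simp add: d_def infdist_le)
  have lim: "(\<lambda>n. dist x (u n)) \<longlonglongrightarrow> d"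
  proof (rule tendsto_sandwich[of "\<lambda>_. d" _ _ "\<lambda>n. d + inverse (real (Suc n))"])
    show "(\<lambda>n. d + inverse (real (Suc n))) \<longlonglongrightarrow> d"
      using tendsto_add[OF tendsto_const LIMSEQ_inverse_real_of_nat, of d] by simp
    show "\<forall>\<^sub>F n in sequentially. d \<le> dist x (u n)"
      using u ge by simp
    show "\<forall>\<^sub>F n in sequentially. dist x (u n) \<le> d + inverse (real (Suc n))"
      using u(2) by (intro always_eventually allI less_imp_le)
  qed (rule tendsto_const)
  define e where "e n = 2 * ((dist x (u n))\<^sup>2 - d\<^sup>2)" for n
  have "e \<longlonglongrightarrow> 2 * (d\<^sup>2 - d\<^sup>2)"
    unfolding e_def by (intro tendsto_intros lim)
  then have e: "e \<longlonglongrightarrow> 0" by simp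
  have "(norm (u m - u n))\<^sup>2 \<le> e m + e n" for m n
  proof -
    \<comment> \<open>The midpoint of \<open>u m\<close> and \<open>u n\<close> has distance at
      least \<open>d\<close> from \<open>x\<close>. Put into the parallelogram law, this bounds the
      squared difference by \<open>e m + e n\<close>, which explains the factor 2 in
      \<open>e\<close>.\<close>
    have "(1/2) *\<^sub>R u m + (1/2) *\<^sub>R u n \<in> C"
      using assms(2) u by (intro convexD) auto
    then have "d\<^sup>2 \<le> (dist x ((1/2) *\<^sub>R u m + (1/2) *\<^sub>R u n))\<^sup>2"
      using ge by (intro power_mono) (auto simp: d_def infdist_nonneg)
    then show ?thesis
      unfolding e_def dist_norm power2_norm_eq_inner
      by (simp add: inner_simps inner_commute algebra_simps)
  qed
  from Cauchy_if_norm_diff_square_le[OF this e] obtain l where l: "u \<longlonglongrightarrow> l"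
    by (auto simp: Cauchy_convergent_iff convergent_def)
  have "l \<in> C" using closed_sequentially[OF assms(1) _ l] u by blast
  moreover have "dist x l = d"
    by (rule LIMSEQ_unique[OF _ lim]) (intro tendsto_intros l)
  ultimately show ?thesis using ge by auto
qed

lemma orth_proj_eqI:
  assumes "closed C" "convex C" "y \<in> C" "\<And>z. z \<in> C \<Longrightarrow> dist x y \<le> dist x z"
  shows "orth_proj C x = y"
  unfolding orth_proj_def
proof (rule the_equality)
  show "y \<in> C \<and> (\<forall>z\<in>C. norm (y - x) \<le> norm (z - x))"
    using assms by (auto simp: dist_norm norm_minus_commute)
  show "w = y" if "w \<in> C \<and> (\<forall>z\<in>C. norm (w - x) \<le> norm (z - x))" for w
    using any_closest_point_unique[of C w y x] that assms
    by (auto simp: dist_norm norm_minus_commute)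
qed

lemma
  fixes C :: "'a::{real_inner, complete_space} set"
  assumes "closed C" "convex C" "C \<noteq> {}"
  shows orth_proj_in: "orth_proj C x \<in> C"
    and dist_orth_proj_le: "z \<in> C \<Longrightarrow> dist x (orth_proj C x) \<le> dist x z"
proof -
  obtain y where y: "y \<in> C" "\<And>z. z \<in> C \<Longrightarrow> dist x y \<le> dist x z"
    using closest_point_exists_complete[OF assms, of x] by blast
  have "orth_proj C x = y"
    by (rule orth_proj_eqI[OF assms(1,2) y])
  with y show "orth_proj C x \<in> C" "z \<in> C \<Longrightarrow> dist x (orth_proj C x) \<le> dist x z"
    by auto
qed

lemma orth_proj_dot:
  fixes C :: "'a::{real_inner, complete_space} set"
  assumes "closed C" "convex C" "z \<in> C"
  shows "inner (x - orth_proj C x) (z - orth_proj C x) \<le> 0"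
proof -
  have "C \<noteq> {}" using assms(3) by blast
  note ne = assms(1,2) this
  show ?thesis
    using dist_orth_proj_le[OF ne]
    by (intro any_closest_point_dot[OF assms(2,1) orth_proj_in[OF ne] assms(3)]) blast
qed

text \<open>The right side minus the left side equals \<open>2 * inner a (b - a)\<close>.\<close>

lemma norm_diff_square_le:
  fixes a b :: "'a::real_inner"
  assumes "0 \<le> inner a (b - a)"
  shows "(norm (b - a))\<^sup>2 \<le> (norm b)\<^sup>2 - (norm a)\<^sup>2"
  using assms by (simp add: power2_norm_eq_inner inner_simps inner_commute)

section \<open>Closedness and convexity of the set of maximizers\<close>

lemma maximizers_eq_halfspace_Int:
  assumes "p \<in> maximizers S c"
  shows "maximizers S c = S \<inter> {x. inner c x \<ge> inner c p}"
  using assms by (force simp: maximizers_def)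

lemma closed_maximizers:
  assumes "closed S"
  shows "closed (maximizers S c)"
proof (cases "maximizers S c = {}")
  case False
  then obtain p where "p \<in> maximizers S c" by blast
  from maximizers_eq_halfspace_Int[OF this] show ?thesis
    using assms by (simp add: closed_Int closed_halfspace_ge)
qed simp

lemma convex_maximizers:
  assumes "convex S"
  shows "convex (maximizers S c)"
proof (cases "maximizers S c = {}")
  case False
  then obtain p where "p \<in> maximizers S c" by blast
  from maximizers_eq_halfspace_Int[OF this] show ?thesis
    using assms by (simp add: convex_Int convex_halfspace_ge)
qed simp

section \<open>Projections of the points on the ray from \<open>x0\<close> in direction
  \<open>c\<close>\<close>

context
  fixes S :: "'a::{real_inner, complete_space} set" and c x0 :: 'a
  assumes S: "closed S" "convex S" "S \<noteq> {}"
begin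

private abbreviation (input) proj_ray :: "real \<Rightarrow> 'a"
  where "proj_ray \<eta> \<equiv> orth_proj S (x0 + \<eta> *\<^sub>R c)"

lemma proj_ray_dot:
  assumes "z \<in> S"
  shows "\<eta> * inner c (z - proj_ray \<eta>) \<le> inner (proj_ray \<eta> - x0) (z - proj_ray \<eta>)"
  using orth_proj_dot[OF S(1,2) assms, of "x0 + \<eta> *\<^sub>R c"]
  by (simp add: inner_simps algebra_simps)

lemma proj_ray_diff_le:
  assumes "0 \<le> \<eta>" "\<eta> \<le> \<mu>"
  shows "(norm (proj_ray \<mu> - proj_ray \<eta>))\<^sup>2
    \<le> (norm (proj_ray \<mu> - x0))\<^sup>2 - (norm (proj_ray \<eta> - x0))\<^sup>2"
proof (cases "\<eta> = \<mu>")
  case False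
  let ?d = "proj_ray \<mu> - proj_ray \<eta>"
  have 1: "\<eta> * inner c ?d \<le> inner (proj_ray \<eta> - x0) ?d"
    by (intro proj_ray_dot orth_proj_in S)
  have "\<mu> * inner c (- ?d) \<le> inner (proj_ray \<mu> - x0) (- ?d)"
    using proj_ray_dot[OF orth_proj_in[OF S], of \<mu> "x0 + \<eta> *\<^sub>R c"] by simp
  then have 2: "inner (proj_ray \<mu> - x0) ?d \<le> \<mu> * inner c ?d"
    by (simp only: inner_minus_right mult_minus_right neg_le_iff_le)
  have "inner (proj_ray \<mu> - x0) ?d - inner (proj_ray \<eta> - x0) ?d = (norm ?d)\<^sup>2"
    by (simp add: power2_norm_eq_inner flip: inner_diff_left)
  \<comment> \<open>Each projection has been tested against the other projected point. The sum of
    both inequalities shows, after cancelling \<open>\<mu> - \<eta> > 0\<close>, that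
    \<open>inner c\<close> does not decrease along the projected ray.\<close>
  with 1 2 have "(norm ?d)\<^sup>2 \<le> (\<mu> - \<eta>) * inner c ?d"
    unfolding left_diff_distrib by linarith
  then have "0 \<le> (\<mu> - \<eta>) * inner c ?d"
    using zero_le_power2 order_trans by blast
  then have "0 \<le> inner c ?d"
    using False assms by (simp add: zero_le_mult_iff)
  then have "0 \<le> \<eta> * inner c ?d"
    using assms by simp
  then have "0 \<le> inner (proj_ray \<eta> - x0) ?d" using 1 by linarith
  then show ?thesis
    using norm_diff_square_le[of "proj_ray \<eta> - x0" "proj_ray \<mu> - x0"] by simp
qed simp

lemma maximizer_proj_ray_diff_le:
  assumes p: "p \<in> maximizers S c" and "0 \<le> \<eta>"
  shows "(norm (p - proj_ray \<eta>))\<^sup>2 \<le> (norm (p - x0))\<^sup>2 - (norm (proj_ray \<eta> - x0))\<^sup>2"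
    and "\<eta> * inner c (p - proj_ray \<eta>) \<le> (norm (p - x0))\<^sup>2"
proof -
  let ?a = "proj_ray \<eta> - x0" and ?b = "p - proj_ray \<eta>"
  have "0 \<le> inner c ?b"
    using p orth_proj_in[OF S] by (auto simp: maximizers_def inner_simps)
  moreover have dot: "\<eta> * inner c ?b \<le> inner ?a ?b"
    using p by (intro proj_ray_dot) (auto simp: maximizers_def)
  ultimately have nn: "0 \<le> inner ?a ?b"
    using \<open>0 \<le> \<eta>\<close> by (meson mult_nonneg_nonneg order_trans)
  show 1: "(norm ?b)\<^sup>2 \<le> (norm (p - x0))\<^sup>2 - (norm ?a)\<^sup>2"
    using nn norm_diff_square_le[of ?a "p - x0"] by simp
  \<comment> \<open>Expand the square of \<open>p - x0 = ?a + ?b\<close>. Dropping the two squares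
    bounds \<open>2 * inner ?a ?b\<close>, and hence the nonnegative \<open>inner ?a ?b\<close>
    itself.\<close>
  have "(norm (p - x0))\<^sup>2 = (norm ?a)\<^sup>2 + 2 * inner ?a ?b + (norm ?b)\<^sup>2"
    using dot_norm[of ?a ?b] by (simp add: field_simps)
  then show "\<eta> * inner c ?b \<le> (norm (p - x0))\<^sup>2"
    using dot nn zero_le_power2[of "norm ?a"] zero_le_power2[of "norm ?b"] by linarith
qed

text \<open>Integer parameters suffice here, since monotonicity in \<open>\<eta>\<close> later
  carries the limit over to real parameters.\<close>

lemma proj_ray_sequence_tendsto:
  assumes ne: "maximizers S c \<noteq> {}"
  shows "(\<lambda>n. proj_ray (real n)) \<longlonglongrightarrow> orth_proj (maximizers S c) x0"
proof -
  define M where "M = maximizers S c"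
  have M: "closed M" "convex M" "M \<noteq> {}"
    using S ne by (auto simp: M_def closed_maximizers convex_maximizers)
  define p where "p = orth_proj M x0"
  have p: "p \<in> maximizers S c"
    using orth_proj_in[OF M] by (simp add: p_def M_def)
  define g where "g n = (norm (proj_ray (real n) - x0))\<^sup>2" for n
  have diff: "(norm (proj_ray (real m) - proj_ray (real n)))\<^sup>2 \<le> g m - g n" if "n \<le> m" for m n
    using proj_ray_diff_le[of "real n" "real m"] that by (simp add: g_def)
  have "g n \<le> g m" if "n \<le> m" for m n
    using diff[OF that] by (smt (verit) zero_le_power2)
  then have "incseq g" by (simp add: incseq_def)
  moreover have g_le: "g n \<le> (norm (p - x0))\<^sup>2" for n
    using maximizer_proj_ray_diff_le(1)[OF p, of "real n"] zero_le_power2[of "norm (p - proj_ray (real n))"]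
    unfolding g_def by linarith
  ultimately obtain L where L: "g \<longlonglongrightarrow> L" "\<And>n. g n \<le> L"
    using incseq_convergent[of g] by blast
  \<comment> \<open>For \<open>n \<le> m\<close>, \<open>g m \<le> L\<close> gives
    \<open>g m - g n \<le> e n \<le> e m + e n\<close>, a bound symmetric in \<open>m\<close> and
    \<open>n\<close>.\<close>
  define e where "e n = L - g n" for n
  have e: "e \<longlonglongrightarrow> 0"
    using tendsto_diff[OF tendsto_const L(1), of L] by (simp add: e_def[abs_def])
  have "(norm (proj_ray (real m) - proj_ray (real n)))\<^sup>2 \<le> e m + e n" for m n
  proof (cases "n \<le> m")
    case True
    then show ?thesis using diff[of n m] L(2)[of m] by (simp add: e_def)
  next
    case False
    then show ?thesis using diff[of m n] L(2)[of n] by (simp add: e_def norm_minus_commute)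
  qed
  from Cauchy_if_norm_diff_square_le[OF this e]
  obtain q where q: "(\<lambda>n. proj_ray (real n)) \<longlonglongrightarrow> q"
    by (auto simp: Cauchy_convergent_iff convergent_def)
  have "q \<in> S"
    using closed_sequentially[OF S(1) _ q] orth_proj_in[OF S] by blast
  moreover have "inner c (p - q) \<le> 0"
  proof (rule LIMSEQ_le)
    show "(\<lambda>n. inner c (p - proj_ray (real n))) \<longlonglongrightarrow> inner c (p - q)"
      by (intro tendsto_intros q)
    show "(\<lambda>n. (norm (p - x0))\<^sup>2 / real n) \<longlonglongrightarrow> 0"
      by (rule lim_const_over_n)
    have "inner c (p - proj_ray (real n)) \<le> (norm (p - x0))\<^sup>2 / real n" if "n \<ge> 1" for n
      using maximizer_proj_ray_diff_le(2)[OF p, of "real n"] that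
      by (simp add: pos_le_divide_eq mult.commute)
    then show "\<exists>N. \<forall>n\<ge>N. inner c (p - proj_ray (real n)) \<le> (norm (p - x0))\<^sup>2 / real n"
      by blast
  qed
  ultimately have "q \<in> M"
    unfolding M_def maximizers_eq_halfspace_Int[OF p] by (simp add: inner_simps)
  moreover have "dist x0 q \<le> dist x0 z" if "z \<in> M" for z
  proof -
    have "norm (proj_ray (real n) - x0) \<le> norm (p - x0)" for n
      using g_le[of n] by (simp add: g_def)
    moreover have "(\<lambda>n. norm (proj_ray (real n) - x0)) \<longlonglongrightarrow> norm (q - x0)"
      by (intro tendsto_intros q)
    ultimately have "norm (q - x0) \<le> norm (p - x0)"
      using LIMSEQ_le_const2 by blast
    \<comment> \<open>As \<open>p\<close> is closest to \<open>x0\<close> within \<open>M\<close>,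
      comparing \<open>q\<close> with \<open>p\<close> settles every \<open>z\<close>.\<close>
    with dist_orth_proj_le[OF M that, of x0] show ?thesis
      by (simp add: p_def dist_norm norm_minus_commute)
  qed
  ultimately have "orth_proj M x0 = q"
    using orth_proj_eqI[OF M(1,2)] by blast
  with q show ?thesis by (simp add: M_def)
qed

end

theorem theorem2p7:
  fixes S :: "'a::{real_inner, complete_space} set"
    and c x0 :: 'a
  assumes "closed S"
    and "convex S"
    and "maximizers S c \<noteq> {}"
  shows "((\<lambda>\<eta>::real. orth_proj S (x0 + \<eta> *\<^sub>R c)) \<longlongrightarrow> orth_proj (maximizers S c) x0) at_top"
proof -
  define p where "p = orth_proj (maximizers S c) x0"
  define y where "y \<eta> = orth_proj S (x0 + \<eta> *\<^sub>R c)" for \<eta> :: real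
  have S: "closed S" "convex S" "S \<noteq> {}"
    using assms by (auto simp: maximizers_def)
  have p: "p \<in> maximizers S c"
    unfolding p_def using assms by (intro orth_proj_in closed_maximizers convex_maximizers)
  have seq: "(\<lambda>n. y (real n)) \<longlonglongrightarrow> p"
    unfolding y_def p_def by (rule proj_ray_sequence_tendsto[OF S assms(3)])
  define g where "g \<eta> = (norm (p - x0))\<^sup>2 - (norm (y \<eta> - x0))\<^sup>2" for \<eta>
  have "(\<lambda>n. g (real n)) \<longlonglongrightarrow> (norm (p - x0))\<^sup>2 - (norm (p - x0))\<^sup>2"
    unfolding g_def by (intro tendsto_intros seq)
  then have g: "(\<lambda>n. g (real n)) \<longlonglongrightarrow> 0" by simp
  have "(y \<longlongrightarrow> p) at_top"
  proof (rule tendstoI)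
    fix r :: real assume r: "0 < r"
    then have "\<forall>\<^sub>F n in sequentially. g (real n) < r\<^sup>2"
      using g by (intro order_tendstoD) auto
    then obtain n where n: "g (real n) < r\<^sup>2"
      by (auto simp: eventually_sequentially)
    \<comment> \<open>\<open>g\<close> bounds the squared distance to \<open>p\<close> and does not
      increase for \<open>\<eta> \<ge> 0\<close>, so one integer with small \<open>g\<close>
      controls all larger reals.\<close>
    have "dist (y \<eta>) p < r" if "\<eta> \<ge> real n" for \<eta>
    proof -
      have "(norm (p - y \<eta>))\<^sup>2 \<le> g \<eta>"
        using maximizer_proj_ray_diff_le(1)[OF S p, of \<eta> x0] that by (simp add: g_def y_def)
      also have "g \<eta> \<le> g (real n)"
        using proj_ray_diff_le[OF S, of "real n" \<eta> x0 c] that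
          zero_le_power2[of "norm (y \<eta> - y (real n))"]
        unfolding g_def y_def by linarith
      finally have "(norm (p - y \<eta>))\<^sup>2 < r\<^sup>2" using n by linarith
      then have "norm (p - y \<eta>) < r" by (rule power2_less_imp_less) (use r in simp)
      then show ?thesis by (simp add: dist_norm norm_minus_commute)
    qed
    then show "\<forall>\<^sub>F \<eta> in at_top. dist (y \<eta>) p < r"
      by (auto simp: eventually_at_top_linorder)
  qed
  then show ?thesis by (simp add: y_def[abs_def] p_def)
qed

end
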